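(* Let $d\geq 2$. Then for all sufficiently large $n$ the following holds: if $\Delta$ is a pure $(d-1)$-dimensional simplicial complex with $n$ vertices and $m$ facets, then $$T(\Delta)\leq n+1-\frac{1}{e}\, n\, m^{-1/d}.$$
   Context: A simplicial complex is pure if all its facets (maximal faces) have the same dimension; a $(d-1)$-dimensional pure complex has facets of size $d$. A transversal of a pure simplicial complex $\Delta$ is a subset of its vertex set that intersects every facet of $\Delta$; the transversal number $T(\Delta)$ is the minimum size of a transversal. *)

theory Defs
  imports Complex_Main
begin

text \<open>Complexes are finite abstract simplicial complexes, given as the set of all their faces
  (including the empty one). Only elements that are faces count as vertices.\<close>

definition simplicial_complex :: "'a set set \<Rightarrow> bool" where
  "simplicial_complex \<Delta> \<longleftrightarrow>
     finite (\<Union>\<Delta>) \<and> {} \<in> \<Delta> \<and> (\<forall>\<sigma>\<in>\<Delta>. \<forall>\<tau>. \<tau> \<subseteq> \<sigma> \<longrightarrow> \<tau> \<in> \<Delta>)"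

definition vertices :: "'a set set \<Rightarrow> 'a set" where
  "vertices \<Delta> = {v. {v} \<in> \<Delta>}"

definition facets :: "'a set set \<Rightarrow> 'a set set" where
  "facets \<Delta> = {\<sigma>\<in>\<Delta>. \<forall>\<tau>\<in>\<Delta>. \<sigma> \<subseteq> \<tau> \<longrightarrow> \<tau> = \<sigma>}"

definition face_dim :: "'a set \<Rightarrow> int" where
  "face_dim \<sigma> = int (card \<sigma>) - 1"

definition complex_dim :: "'a set set \<Rightarrow> int" where
  "complex_dim \<Delta> = Max (face_dim ` \<Delta>)"

definition pure :: "'a set set \<Rightarrow> bool" where
  "pure \<Delta> \<longleftrightarrow> (\<forall>\<sigma>\<in>facets \<Delta>. \<forall>\<tau>\<in>facets \<Delta>. face_dim \<sigma> = face_dim \<tau>)"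

definition transversal :: "'a set set \<Rightarrow> 'a set \<Rightarrow> bool" where
  "transversal \<Delta> S \<longleftrightarrow> S \<subseteq> vertices \<Delta> \<and> (\<forall>\<sigma>\<in>facets \<Delta>. S \<inter> \<sigma> \<noteq> {})"

text \<open>Meaningful when some transversal exists, i.e. unless the empty face is a facet.\<close>

definition transversal_number :: "'a set set \<Rightarrow> nat" where
  "transversal_number \<Delta> = (LEAST k. \<exists>S. transversal \<Delta> S \<and> card S = k)"

end

theory Submission
  imports Defs
begin

text \<open>The complement of a vertex set that contains no facet is a transversal, so one needs a
  facet-free set of \<open>k = \<lfloor>n m\<^bsup>-1/d\<^esup> / e\<rfloor>\<close> vertices. Remove the vertices one at a time, always one
  lying in the largest number of surviving facets. By averaging and Bernoulli's inequality, passing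
  from \<open>j + 1\<close> to \<open>j\<close> vertices multiplies the number of surviving facets by at most
  \<open>1 - d/(j + 1) \<le> (j/(j + 1))\<^sup>d\<close>, so at most \<open>m (k/n)\<^sup>d \<le> e\<^bsup>-d\<^esup> < 1\<close> facets are left at the end.\<close>

text \<open>Double counting of the pairs \<open>v \<in> \<sigma>\<close>: the degrees add up to
  \<open>d * card E\<close>, so they cannot all lie below the average
  \<open>d * card E / card S\<close>. The average is stated without division.\<close>

lemma exists_vertex_of_large_degree:
  fixes E :: "'a set set"
  assumes "finite S" "S \<noteq> {}" "finite E"
    and "\<And>\<sigma>. \<sigma> \<in> E \<Longrightarrow> \<sigma> \<subseteq> S \<and> card \<sigma> = d"
  shows "\<exists>v\<in>S. d * card E \<le> card S * card {\<sigma>\<in>E. v \<in> \<sigma>}"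
proof (rule ccontr)
  assume "\<not> ?thesis"
  \<comment> \<open>By the degree sum below, both sides equal \<open>card S * (d * card E)\<close>,
    which contradicts the strict inequality.\<close>
  then have "(\<Sum>v\<in>S. card S * card {\<sigma>\<in>E. v \<in> \<sigma>}) < (\<Sum>v\<in>S. d * card E)"
    using assms by (intro sum_strict_mono) auto
  moreover have "(\<Sum>v\<in>S. card {\<sigma>\<in>E. v \<in> \<sigma>}) = d * card E"
  proof (rule sum_multicount)
    have "{v\<in>S. v \<in> \<sigma>} = \<sigma>" if "\<sigma> \<in> E" for \<sigma>
      using assms(4)[OF that] by auto
    then show "\<forall>\<sigma>\<in>E. card {v\<in>S. v \<in> \<sigma>} = d"
      using assms(4) by simp
  qed (use assms in auto)
  ultimately show False
    by (simp flip: sum_distrib_left)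
qed

text \<open>The factors \<open>(j / (j + 1)) ^ d\<close> for k \<le> j < \<open>card V\<close>
  telescope to \<open>(k / card V) ^ d\<close>; the bound states this with the denominator cleared.
  The induction runs downward from \<open>card V\<close> to \<open>k\<close>.\<close>

lemma exists_subset_with_few_edges:
  fixes F :: "'a set set"
  assumes "finite V" "finite F"
    and edges: "\<And>\<sigma>. \<sigma> \<in> F \<Longrightarrow> \<sigma> \<subseteq> V \<and> card \<sigma> = d"
    and "k \<le> card V"
  shows "\<exists>S\<subseteq>V. card S = k \<and>
    real (card {\<sigma>\<in>F. \<sigma> \<subseteq> S}) * real (card V) ^ d \<le> real (card F) * real k ^ d"
  using \<open>k \<le> card V\<close>
proof (induction rule: inc_induct)
  case base
  have "{\<sigma>\<in>F. \<sigma> \<subseteq> V} = F"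
    using edges by auto
  then show ?case
    by (intro exI[of _ V]) simp
next
  case (step j)
  then obtain S where S: "S \<subseteq> V" "card S = Suc j"
    and few: "real (card {\<sigma>\<in>F. \<sigma> \<subseteq> S}) * real (card V) ^ d \<le> real (card F) * real (Suc j) ^ d"
    by blast
  define E where "E = {\<sigma>\<in>F. \<sigma> \<subseteq> S}"
  have "finite S"
    using S(1) \<open>finite V\<close> by (rule finite_subset)
  have "S \<noteq> {}" "finite E"
    using S(2) \<open>finite F\<close> by (auto simp: E_def)
  have "\<sigma> \<subseteq> S \<and> card \<sigma> = d" if "\<sigma> \<in> E" for \<sigma>
    using that edges by (simp add: E_def)
  from exists_vertex_of_large_degree[OF \<open>finite S\<close> \<open>S \<noteq> {}\<close> \<open>finite E\<close> this]
  obtain v where v: "v \<in> S" "d * card E \<le> card S * card {\<sigma>\<in>E. v \<in> \<sigma>}"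
    by blast
  define r where "r = card {\<sigma>\<in>F. \<sigma> \<subseteq> S - {v}}"
  \<comment> \<open>Deleting \<open>v\<close> destroys exactly the edges through \<open>v\<close>;
    the others lie in \<open>S - {v}\<close>.\<close>
  have "{\<sigma>\<in>E. v \<in> \<sigma>} \<union> {\<sigma>\<in>F. \<sigma> \<subseteq> S - {v}} = E"
    by (auto simp: E_def)
  moreover have "card ({\<sigma>\<in>E. v \<in> \<sigma>} \<union> {\<sigma>\<in>F. \<sigma> \<subseteq> S - {v}}) = card {\<sigma>\<in>E. v \<in> \<sigma>} + r"
    using \<open>finite E\<close> \<open>finite F\<close> unfolding r_def by (intro card_Un_disjoint) auto
  ultimately have "card E = card {\<sigma>\<in>E. v \<in> \<sigma>} + r"
    by (simp only:)
  moreover have "real d * real (card E) \<le> real (Suc j) * real (card {\<sigma>\<in>E. v \<in> \<sigma>})"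
    using v(2) S(2) by (metis of_nat_le_iff of_nat_mult)
  \<comment> \<open>The factor has the shape \<open>1 + d * x\<close> with
    \<open>x = - 1 / real (Suc j)\<close>, ready for Bernoulli's inequality, whose condition x \<ge>
    -1 holds even at \<open>j = 0\<close>.\<close>
  ultimately have "real r \<le> real (card E) * (1 + real d * (- 1 / real (Suc j)))"
    by (simp add: field_simps)
  also have "\<dots> \<le> real (card E) * (1 + (- 1 / real (Suc j))) ^ d"
    by (intro mult_left_mono Bernoulli_inequality) (auto simp: field_simps)
  also have "1 + (- 1 / real (Suc j)) = real j / real (Suc j)"
    by (simp add: field_simps)
  finally have "real r * real (card V) ^ d
      \<le> real (card E) * (real j / real (Suc j)) ^ d * real (card V) ^ d"
    by (intro mult_right_mono) auto
  also have "\<dots> = (real (card E) * real (card V) ^ d) * (real j / real (Suc j)) ^ d"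
    by (simp only: mult_ac)
  also have "\<dots> \<le> (real (card F) * real (Suc j) ^ d) * (real j / real (Suc j)) ^ d"
    using few unfolding E_def by (intro mult_right_mono) auto
  also have "\<dots> = real (card F) * real j ^ d"
    by (simp add: power_divide del: of_nat_Suc)
  finally show ?case
    using S v(1) \<open>finite S\<close> unfolding r_def by (intro exI[of _ "S - {v}"]) auto
qed

lemma finite_simplicial_complex:
  assumes "simplicial_complex \<Delta>"
  shows "finite \<Delta>"
  using assms unfolding simplicial_complex_def by (elim conjE) (rule finite_UnionD)

lemma vertices_eq_Union:
  assumes "simplicial_complex \<Delta>"
  shows "vertices \<Delta> = \<Union>\<Delta>"
proof -
  have "{v} \<in> \<Delta>" if "\<sigma> \<in> \<Delta>" "v \<in> \<sigma>" for v \<sigma>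
    using assms that by (simp add: simplicial_complex_def)
  then show ?thesis
    by (auto simp: vertices_def)
qed

text \<open>Purity only makes all facets equally large. A face of maximal dimension has no proper
  superface, so it is a facet, and it fixes the common size as \<open>d\<close>.\<close>

lemma card_facet:
  assumes sc: "simplicial_complex \<Delta>" and "pure \<Delta>" and dim: "complex_dim \<Delta> = int d - 1"
    and "\<sigma> \<in> facets \<Delta>"
  shows "card \<sigma> = d"
proof -
  have "finite \<Delta>" and "\<Delta> \<noteq> {}"
    using finite_simplicial_complex[OF sc] sc by (auto simp: simplicial_complex_def)
  then have "complex_dim \<Delta> \<in> face_dim ` \<Delta>"
    unfolding complex_dim_def by (intro Max_in) auto
  then obtain \<rho> where \<rho>: "\<rho> \<in> \<Delta>" "face_dim \<rho> = complex_dim \<Delta>"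
    by auto
  have "\<tau> = \<rho>" if "\<tau> \<in> \<Delta>" "\<rho> \<subseteq> \<tau>" for \<tau>
  proof -
    have "face_dim \<tau> \<le> face_dim \<rho>"
      unfolding \<rho>(2) complex_dim_def using \<open>finite \<Delta>\<close> that(1) by simp
    then have "card \<tau> \<le> card \<rho>"
      by (simp add: face_dim_def)
    moreover have "finite \<tau>"
      using sc that(1) unfolding simplicial_complex_def
      by (meson Union_upper finite_subset)
    ultimately show ?thesis
      using that(2) card_seteq by blast
  qed
  then have "\<rho> \<in> facets \<Delta>"
    using \<rho>(1) by (simp add: facets_def)
  then have "face_dim \<sigma> = face_dim \<rho>"
    using assms(2,4) unfolding pure_def by blast
  then have "face_dim \<sigma> = int d - 1"
    using dim \<rho>(2) by simp
  then show ?thesis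
    by (simp add: face_dim_def)
qed

lemma transversal_number_le_complement:
  assumes sc: "simplicial_complex \<Delta>" and S: "S \<subseteq> vertices \<Delta>"
    and free: "\<And>\<sigma>. \<sigma> \<in> facets \<Delta> \<Longrightarrow> \<not> \<sigma> \<subseteq> S"
  shows "transversal_number \<Delta> \<le> card (vertices \<Delta>) - card S"
proof -
  have "finite (vertices \<Delta>)"
    using sc vertices_eq_Union[OF sc] by (simp add: simplicial_complex_def)
  with S have "finite S"
    by (rule finite_subset)
  have "\<sigma> \<subseteq> vertices \<Delta>" if "\<sigma> \<in> facets \<Delta>" for \<sigma>
    using that vertices_eq_Union[OF sc] by (auto simp: facets_def)
  then have "transversal \<Delta> (vertices \<Delta> - S)"
    using free unfolding transversal_def by blast
  then show ?thesis
    unfolding transversal_number_def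
    by (intro Least_le exI[of _ "vertices \<Delta> - S"]) (simp add: card_Diff_subset \<open>finite S\<close> S)
qed

text \<open>The assumption \<open>small\<close> pushes the bound on the number of facets inside a
  suitable \<open>k\<close>-set below 1. That number is an integer, hence 0, and the complement of
  the set is a transversal.\<close>

lemma transversal_number_le:
  assumes sc: "simplicial_complex \<Delta>" and "pure \<Delta>" and "complex_dim \<Delta> = int d - 1"
    and k: "k \<le> card (vertices \<Delta>)"
    and small: "real (card (facets \<Delta>)) * real k ^ d < real (card (vertices \<Delta>)) ^ d"
  shows "transversal_number \<Delta> \<le> card (vertices \<Delta>) - k"
proof -
  have fin: "finite (vertices \<Delta>)" "finite (facets \<Delta>)"
    using sc vertices_eq_Union[OF sc] finite_simplicial_complex[OF sc]
    by (auto simp: simplicial_complex_def facets_def)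
  have "\<sigma> \<subseteq> vertices \<Delta> \<and> card \<sigma> = d" if "\<sigma> \<in> facets \<Delta>" for \<sigma>
    using that card_facet assms(1-3) vertices_eq_Union[OF sc] by (auto simp: facets_def)
  from exists_subset_with_few_edges[OF fin this k] obtain S
    where S: "S \<subseteq> vertices \<Delta>" "card S = k"
    and few: "real (card {\<sigma>\<in>facets \<Delta>. \<sigma> \<subseteq> S}) * real (card (vertices \<Delta>)) ^ d
      \<le> real (card (facets \<Delta>)) * real k ^ d"
    by blast
  let ?c = "card {\<sigma>\<in>facets \<Delta>. \<sigma> \<subseteq> S}"
  have "?c = 0"
  proof (rule ccontr)
    assume "?c \<noteq> 0"
    then have "1 * real (card (vertices \<Delta>)) ^ d \<le> real ?c * real (card (vertices \<Delta>)) ^ d"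
      by (intro mult_right_mono) auto
    then show False
      using few small by linarith
  qed
  then have "\<not> \<sigma> \<subseteq> S" if "\<sigma> \<in> facets \<Delta>" for \<sigma>
    using that fin(2) by auto
  from transversal_number_le_complement[OF sc S(1) this] show ?thesis
    by (simp add: S(2))
qed

theorem theorem3p1:
  fixes d :: nat
  assumes "d \<ge> 2"
  shows "\<forall>\<^sub>F n in sequentially. \<forall>(\<Delta> :: 'a set set) (m :: nat).
           simplicial_complex \<Delta> \<and> pure \<Delta> \<and> complex_dim \<Delta> = int d - 1 \<and>
           card (vertices \<Delta>) = n \<and> card (facets \<Delta>) = m \<longrightarrow>
           real (transversal_number \<Delta>)
             \<le> real n + 1 - 1 / exp 1 * real n * real m powr (- 1 / real d)"
  \<comment> \<open>Positivity of \<open>n\<close> makes \<open>real n ^ d\<close> positive, so that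
    the last estimate is strict.\<close>
  using eventually_gt_at_top[of 0]
proof eventually_elim
  case (elim n)
  show ?case
  proof (intro allI impI, elim conjE)
    fix \<Delta> :: "'a set set" and m :: nat
    assume \<Delta>: "simplicial_complex \<Delta>" "pure \<Delta>" "complex_dim \<Delta> = int d - 1"
      and n: "card (vertices \<Delta>) = n" and m: "card (facets \<Delta>) = m"
    define p where "p = real m powr (- 1 / real d)"
    define x where "x = 1 / exp 1 * real n * p"
    define k where "k = nat \<lfloor>x\<rfloor>"
    have "p \<ge> 0"
      by (simp add: p_def)
    \<comment> \<open>For \<open>m = 0\<close> the convention \<open>0 powr a = 0\<close> gives
      \<open>p = 0\<close>; otherwise m \<ge> 1 and the exponent is not positive.\<close>
    have "p \<le> 1"
    proof (cases "m = 0")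
      case False
      then have "real m powr (- 1 / real d) \<le> real m powr 0"
        by (intro powr_mono) auto
      then show ?thesis
        using False by (simp add: p_def)
    qed (simp add: p_def)
    have mp: "real m * p ^ d \<le> 1"
    proof (cases "m = 0")
      case False
      have "p ^ d = real m powr (real d * (- 1 / real d))"
        unfolding p_def using False by (intro powr_power) simp
      then show ?thesis
        using assms False by (simp add: powr_minus_divide)
    qed simp
    have "x \<ge> 0"
      unfolding x_def using \<open>p \<ge> 0\<close> by simp
    \<comment> \<open>Rounding down loses less than 1, which is the summand 1 in the final
      bound.\<close>
    then have k: "real k \<le> x" "x < real k + 1"
      unfolding k_def by linarith+
    have e: "1 / exp 1 < (1::real)"
      by simp
    have "x \<le> 1 * real n * 1"
      \<comment> \<open>All three factors are bounded separately, so that \<open>k\<close> vertices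
        can be chosen among \<open>n\<close> and the natural subtraction \<open>n - k\<close> does
        not truncate.\<close>
      unfolding x_def using \<open>p \<ge> 0\<close> \<open>p \<le> 1\<close> e by (intro mult_mono) auto
    with k have "k \<le> n"
      by linarith
    have "real m * real k ^ d \<le> real m * x ^ d"
      using k by (intro mult_left_mono power_mono) auto
    also have "\<dots> = (real m * p ^ d) * ((1 / exp 1) ^ d * real n ^ d)"
      by (simp add: x_def power_mult_distrib power_divide)
    also have "\<dots> \<le> 1 * ((1 / exp 1) ^ d * real n ^ d)"
      using mp by (intro mult_right_mono) auto
    \<comment> \<open>Here the constant \<open>1 / exp 1\<close> enters: its \<open>d\<close>-th
      power is below 1 because \<open>d\<close> is positive.\<close>
    also have "\<dots> < real n ^ d"
      using power_strict_mono[OF e, of d] assms elim by (simp add: power_one)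
    finally have "transversal_number \<Delta> \<le> n - k"
      using transversal_number_le[OF \<Delta>, of k] \<open>k \<le> n\<close> n m by simp
    then have "real (transversal_number \<Delta>) \<le> real n - real k"
      using \<open>k \<le> n\<close> by linarith
    then show "real (transversal_number \<Delta>)
        \<le> real n + 1 - 1 / exp 1 * real n * real m powr (- 1 / real d)"
      using k(2) unfolding x_def p_def by linarith
  qed
qed

end
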